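(* Let $G$ be a connected cograph on $n$ vertices with cotree $T_G$ having $r$ interior vertices $w_1,\dots,w_r$, where $w_1$ is the root of $T_G$. For each $i$, let $s_i$ be the number of children of $w_i$ that are interior vertices and $t_i$ the number of children of $w_i$ that are leaves. Then the number of spanning trees of $G$ equals $$\prod_{i=2}^{r}\delta(w_i)^{\,s_i+t_i-1}\cdot n^{\,s_1+t_1-2},$$ where $\delta(w_i)$ is the degree of the interior vertex $w_i$.
   Context: A cograph is a graph with no induced path on four vertices. The cotree $T_G$ of a cograph $G$ is the rooted tree whose leaves are the vertices of $G$, whose interior vertices are each labelled $\cup$ or $\otimes$, every interior vertex having at least two children, with labels alternating along every root-to-leaf path (root of type $\otimes$ when $G$ is connected), and such that two vertices of $G$ are adjacent iff their least common ancestor in $T_G$ is of $\otimes$-type. For interior vertices $w_i,w_j$, $lca(w_i,w_j)$ denotes their least common ancestor (with $lca(w_j,w_j)=w_j$). The degree of an interior vertex $w_j$ is $\delta(w_j)=$ the number of leaves $v$ of $T_G$ whose parent $w_i$ satisfies that $lca(w_i,w_j)$ is of $\otimes$-type. A spanning tree of a connected graph on $n$ vertices is a connected subgraph with all $n$ vertices and $n-1$ edges. *)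

theory Defs
  imports Main
begin

text \<open>Simple graphs are given by a vertex set and a set of two-element edges.\<close>

definition simple_graph :: "'a set \<Rightarrow> 'a set set \<Rightarrow> bool" where
  "simple_graph V E \<longleftrightarrow> finite V \<and> (\<forall>e\<in>E. e \<subseteq> V \<and> card e = 2)"

definition connected_graph :: "'a set \<Rightarrow> 'a set set \<Rightarrow> bool" where
  "connected_graph V E \<longleftrightarrow> V \<noteq> {} \<and> (\<forall>u\<in>V. \<forall>v\<in>V. (u, v) \<in> {(x, y). {x, y} \<in> E}\<^sup>*)"

definition cograph :: "'a set \<Rightarrow> 'a set set \<Rightarrow> bool" where
  "cograph V E \<longleftrightarrow> simple_graph V E \<and>
     \<not> (\<exists>a\<in>V. \<exists>b\<in>V. \<exists>c\<in>V. \<exists>d\<in>V. distinct [a, b, c, d] \<and>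
          {a, b} \<in> E \<and> {b, c} \<in> E \<and> {c, d} \<in> E \<and>
          {a, c} \<notin> E \<and> {b, d} \<notin> E \<and> {a, d} \<notin> E)"

text \<open>A spanning subgraph contains all vertices, so it is determined by its edge set.\<close>

definition spanning_trees :: "'a set \<Rightarrow> 'a set set \<Rightarrow> 'a set set set" where
  "spanning_trees V E = {F. F \<subseteq> E \<and> connected_graph V F \<and> card F = card V - 1}"

datatype cotree_label = UnionNode | JoinNode

text \<open>The values of \<open>tparent\<close> at the root and of \<open>tlabel\<close> at the leaves carry no information.\<close>

record 'a cotree =
  tnodes :: "'a set"
  troot :: 'a
  tparent :: "'a \<Rightarrow> 'a"
  tlabel :: "'a \<Rightarrow> cotree_label"

definition parent_rel :: "'a cotree \<Rightarrow> ('a \<times> 'a) set" where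
  "parent_rel T = {(x, tparent T x) | x. x \<in> tnodes T - {troot T}}"

definition rooted_tree :: "'a cotree \<Rightarrow> bool" where
  "rooted_tree T \<longleftrightarrow> finite (tnodes T) \<and> troot T \<in> tnodes T \<and>
     parent_rel T \<subseteq> tnodes T \<times> tnodes T \<and>
     (\<forall>x\<in>tnodes T. (x, troot T) \<in> (parent_rel T)\<^sup>*)"

definition tree_children :: "'a cotree \<Rightarrow> 'a \<Rightarrow> 'a set" where
  "tree_children T w = {x. (x, w) \<in> parent_rel T}"

definition tree_leaves :: "'a cotree \<Rightarrow> 'a set" where
  "tree_leaves T = {x \<in> tnodes T. tree_children T x = {}}"

definition interior_nodes :: "'a cotree \<Rightarrow> 'a set" where
  "interior_nodes T = tnodes T - tree_leaves T"

definition is_ancestor :: "'a cotree \<Rightarrow> 'a \<Rightarrow> 'a \<Rightarrow> bool" where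
  "is_ancestor T a x \<longleftrightarrow> (x, a) \<in> (parent_rel T)\<^sup>*"

definition lca :: "'a cotree \<Rightarrow> 'a \<Rightarrow> 'a \<Rightarrow> 'a" where
  "lca T x y = (THE z. is_ancestor T z x \<and> is_ancestor T z y \<and>
     (\<forall>a. is_ancestor T a x \<and> is_ancestor T a y \<longrightarrow> is_ancestor T a z))"

definition is_cotree_of :: "'a cotree \<Rightarrow> 'a set \<Rightarrow> 'a set set \<Rightarrow> bool" where
  "is_cotree_of T V E \<longleftrightarrow> rooted_tree T \<and> tree_leaves T = V \<and>
     (\<forall>w\<in>interior_nodes T. 2 \<le> card (tree_children T w)) \<and>
     (\<forall>w\<in>interior_nodes T. \<forall>c\<in>tree_children T w \<inter> interior_nodes T. tlabel T c \<noteq> tlabel T w) \<and>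
     (connected_graph V E \<and> troot T \<in> interior_nodes T \<longrightarrow> tlabel T (troot T) = JoinNode) \<and>
     (\<forall>u\<in>V. \<forall>v\<in>V. u \<noteq> v \<longrightarrow> ({u, v} \<in> E \<longleftrightarrow> tlabel T (lca T u v) = JoinNode))"

definition interior_degree :: "'a cotree \<Rightarrow> 'a \<Rightarrow> nat" where
  "interior_degree T w = card {v \<in> tree_leaves T. tlabel T (lca T (tparent T v) w) = JoinNode}"

definition num_interior_children :: "'a cotree \<Rightarrow> 'a \<Rightarrow> nat" where
  "num_interior_children T w = card (tree_children T w \<inter> interior_nodes T)"

definition num_leaf_children :: "'a cotree \<Rightarrow> 'a \<Rightarrow> nat" where
  "num_leaf_children T w = card (tree_children T w \<inter> tree_leaves T)"

end

theory Submission
  imports Defs "HOL-Computational_Algebra.Polynomial"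
begin

text \<open>
  A rooted spanning forest of \<open>S\<close> is encoded by its parent map \<open>f\<close>, with \<open>f v = None\<close> at the
  roots. Give each vertex \<open>v\<close> a \<^emph>\<open>row\<close> \<open>r v\<close> of weights for its possible values \<open>f v\<close>, and let
  \<open>forest_sum S r\<close> be the total weight of all forests. If \<open>u\<close> and \<open>v\<close> have the same row with total
  \<open>Q\<close>, then the sum is \<open>Q\<close> times the sum in which \<open>u\<close> is forced to point to \<open>v\<close>. Moreover, an entry
  of a row may be changed freely if using it would close a cycle with forced arcs.

  Take all nodes of the cotree as vertices. Let each node \<open>z\<close> be a root with weight \<open>X\<close>, and point
  with weight 1 to those leaves \<open>x\<close> for which the least common ancestor of \<open>z\<close> and the parent of
  \<open>x\<close> is a join node; the total of this row is \<open>X + \<delta>(z)\<close>. The rows of the leaves are, up to loops,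
  the adjacency rows of the graph. The interior nodes are never pointed to, so each of them merely
  contributes its total as a factor to the forest sum.

  On the other hand, this sum can be computed by working up the cotree: the row of a child of \<open>w\<close>
  differs from that of \<open>w\<close> only in arcs to its own descendants, which are already forced towards it.
  Forcing the \<open>s + t\<close> children of \<open>w\<close> to point to \<open>w\<close> thus yields a factor
  \<open>(X + \<delta>(w)) ^ (s + t)\<close>, and in the end only the cotree itself is left, with weight \<open>X\<close> at its
  root.

  Cancelling, the forest sum of the graph is \<open>X\<close> times the product of all
  \<open>(X + \<delta>(w)) ^ (s + t - 1)\<close>. Its coefficient of \<open>X\<close> counts the spanning trees with a distinguished
  root, i.e. each spanning tree \<open>n\<close> times, and \<open>\<delta>(w\<^sub>1) = n\<close>.
\<close>

section \<open>Rooted forests and their weighted sums\<close>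

lemma rtrancl_descent:
  obtains d :: "'a \<Rightarrow> nat"
  where "\<And>x. \<lbrakk>(x, z) \<in> R\<^sup>*; x \<noteq> z\<rbrakk> \<Longrightarrow> \<exists>y. (x, y) \<in> R \<and> d y < d x"
proof
  define d where "d x = (LEAST k. (x, z) \<in> R ^^ k)" for x
  fix x assume "(x, z) \<in> R\<^sup>*" "x \<noteq> z"
  then obtain k where "(x, z) \<in> R ^^ k" using rtrancl_imp_relpow by blast
  hence path: "(x, z) \<in> R ^^ d x" unfolding d_def by (rule LeastI)
  with \<open>x \<noteq> z\<close> obtain k where k: "d x = Suc k" by (cases "d x") auto
  with path obtain y where "(x, y) \<in> R" "(y, z) \<in> R ^^ k" by (metis relpow_Suc_D2)
  moreover from this have "d y \<le> k" unfolding d_def by (auto intro: Least_le)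
  ultimately show "\<exists>y. (x, y) \<in> R \<and> d y < d x" using k by auto
qed

lemma acyclic_if_reaches_sink:
  assumes "single_valued R" "z \<notin> Domain R" and reach: "\<And>x. x \<in> Domain R \<Longrightarrow> (x, z) \<in> R\<^sup>*"
  shows "acyclic R"
proof -
  obtain d :: "'a \<Rightarrow> nat"
    where d: "\<And>x. \<lbrakk>(x, z) \<in> R\<^sup>*; x \<noteq> z\<rbrakk> \<Longrightarrow> \<exists>y. (x, y) \<in> R \<and> d y < d x"
    using rtrancl_descent by metis
  show ?thesis
  proof (rule acyclicI_order)
    fix x y assume "(x, y) \<in> R"
    moreover from this obtain y' where "(x, y') \<in> R" "d y' < d x"
      using d reach assms(2) by (metis Domain.DomainI)
    ultimately show "d y < d x" using assms(1) by (metis single_valuedD)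
  qed
qed

definition forests :: "'a set \<Rightarrow> ('a \<rightharpoonup> 'a) set" where
  "forests S = {f. dom f \<subseteq> S \<and> ran f \<subseteq> S \<and> acyclic (Map.graph f)}"

definition rooted_trees :: "'a set \<Rightarrow> 'a \<Rightarrow> ('a \<rightharpoonup> 'a) set" where
  "rooted_trees S \<rho> = {f \<in> forests S. \<rho> \<in> S \<and> dom f = S - {\<rho>}}"

definition targets :: "'a set \<Rightarrow> 'a option set" where
  "targets S = insert None (Some ` S)"

type_synonym ('a, 'b) rows = "'a \<Rightarrow> 'a option \<Rightarrow> 'b"

definition forest_sum :: "'a set \<Rightarrow> ('a, 'b::comm_semiring_1) rows \<Rightarrow> 'b" where
  "forest_sum S r = (\<Sum>f\<in>forests S. \<Prod>v\<in>S. r v (f v))"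

lemma finite_targets: "finite S \<Longrightarrow> finite (targets S)"
  by (simp add: targets_def)

lemma forest_value_targets: "f \<in> forests S \<Longrightarrow> f x \<in> targets S"
  by (cases "f x") (auto simp: forests_def targets_def ran_def)

lemma finite_forests:
  assumes "finite S"
  shows "finite (forests S)"
proof (rule finite_subset)
  show "forests S \<subseteq> (\<Union>A\<in>Pow S. {m. dom m = A \<and> ran m \<subseteq> S})"
    by (auto simp: forests_def)
  show "finite (\<Union>A\<in>Pow S. {m. dom m = A \<and> ran m \<subseteq> S})"
    using assms by (auto intro!: finite_set_of_finite_maps dest: finite_subset)
qed

lemma single_valued_graph: "single_valued (Map.graph f)"
  by (auto simp: single_valued_def Map.graph_def)

lemma graph_mono: "f \<subseteq>\<^sub>m g \<Longrightarrow> Map.graph f \<subseteq> Map.graph g"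
  by (force simp: Map.graph_def map_le_def)

lemma forest_no_back_arc:
  assumes "f \<in> forests S" "f v = Some z"
  shows "(z, v) \<notin> (Map.graph f)\<^sup>*"
  using assms rtrancl_into_trancl2[of v z "Map.graph f"]
  by (auto simp: forests_def acyclic_def in_graphI)

lemma forest_restrict:
  assumes "f \<in> forests S"
  shows "f |` A \<in> forests S"
proof -
  have "f |` A \<subseteq>\<^sub>m f" by (auto simp: map_le_def)
  hence "acyclic (Map.graph (f |` A))"
    using assms by (auto simp: forests_def intro: acyclic_subset dest: graph_mono)
  thus ?thesis using assms by (auto simp: forests_def ran_def restrict_map_def split: if_splits)
qed

lemma acyclic_graph_upd:
  assumes "g u = None"
  shows "acyclic (Map.graph (g(u := \<alpha>))) \<longleftrightarrow>
    acyclic (Map.graph g) \<and> (\<forall>a. \<alpha> = Some a \<longrightarrow> (a, u) \<notin> (Map.graph g)\<^sup>*)"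
  using assms by (cases \<alpha>) (auto simp: fun_upd_idem acyclic_insert)

lemma rooted_tree_reaches_root:
  assumes "finite S" "f \<in> rooted_trees S \<rho>" "x \<in> S"
  shows "(x, \<rho>) \<in> (Map.graph f)\<^sup>*"
proof -
  have f: "dom f = S - {\<rho>}" "ran f \<subseteq> S" "acyclic (Map.graph f)"
    using assms(2) by (auto simp: rooted_trees_def forests_def)
  have "finite (Map.graph f)" using assms(1) f(1) by simp
  hence "wf ((Map.graph f)\<inverse>)" using f(3) by (rule finite_acyclic_wf_converse)
  thus ?thesis using assms(3)
  proof (induction x rule: wf_induct_rule)
    case (less x)
    show ?case
    proof (cases "x = \<rho>")
      case False
      then obtain y where "f x = Some y" using less.prems f(1) by blast
      hence "(x, y) \<in> Map.graph f" "y \<in> S" using f(2) by (auto simp: in_graphI ran_def)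
      thus ?thesis using less.IH[of y] by (simp add: converse_rtrancl_into_rtrancl)
    qed simp
  qed
qed

section \<open>Forced arcs\<close>

definition forced :: "'a \<Rightarrow> 'a option \<Rightarrow> 'b::comm_semiring_1" where
  "forced x y = of_bool (y = Some x)"

definition force :: "('a \<rightharpoonup> 'a) \<Rightarrow> ('a, 'b::comm_semiring_1) rows \<Rightarrow> ('a, 'b) rows" where
  "force h r v = (case h v of None \<Rightarrow> r v | Some x \<Rightarrow> forced x)"

lemma force_empty: "force Map.empty r = r"
  by (simp add: fun_eq_iff force_def)

lemma force_map_add: "force (h ++ k) r = force k (force h r)"
  by (simp add: fun_eq_iff force_def map_add_def split: option.split)

definition targets_reaching :: "'a set \<Rightarrow> ('a \<rightharpoonup> 'a) \<Rightarrow> 'a \<Rightarrow> 'a option set" where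
  "targets_reaching S g u = Some ` {y \<in> S. (y, u) \<in> (Map.graph g)\<^sup>*}"

lemma targets_reaching_subset: "targets_reaching S g u \<subseteq> targets S"
  by (auto simp: targets_reaching_def targets_def)

lemma forest_sum_force:
  assumes "finite S" "dom h \<subseteq> S"
  shows "forest_sum S (force h r) =
    (\<Sum>f\<in>{f \<in> forests S. h \<subseteq>\<^sub>m f}. \<Prod>v\<in>S - dom h. r v (f v))"
proof -
  have "(\<Prod>v\<in>S. force h r v (f v)) = (\<Prod>v\<in>S - dom h. r v (f v)) * of_bool (h \<subseteq>\<^sub>m f)" for f
  proof -
    have "(\<Prod>v\<in>S - dom h. force h r v (f v)) = (\<Prod>v\<in>S - dom h. r v (f v))"
      by (rule prod.cong) (auto simp: force_def split: option.split)
    moreover have "(\<Prod>v\<in>dom h. force h r v (f v)) = of_bool (h \<subseteq>\<^sub>m f)"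
    proof (cases "h \<subseteq>\<^sub>m f")
      case True
      hence "force h r v (f v) = 1" if "v \<in> dom h" for v
        using that by (force simp: force_def forced_def map_le_def split: option.splits)
      thus ?thesis using True by simp
    next
      case False
      then obtain v where v: "v \<in> dom h" "h v \<noteq> f v" by (auto simp: map_le_def)
      hence "force h r v (f v) = 0" by (auto simp: force_def forced_def)
      hence "(\<Prod>v\<in>dom h. force h r v (f v)) = 0"
        using v(1) finite_subset[OF assms(2,1)] by (intro prod_zero) auto
      thus ?thesis using False by simp
    qed
    ultimately show ?thesis
      using prod.subset_diff[OF assms(2,1), of "\<lambda>v. force h r v (f v)"] by (simp only:)
  qed
  thus ?thesis
    unfolding forest_sum_def using finite_forests[OF assms(1)]
    by (simp add: sum_mult_of_bool_eq Int_def)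
qed

lemma forest_sum_force_cong:
  assumes "finite S" "dom h \<subseteq> S"
    and eq: "\<And>v y. \<lbrakk>v \<in> S - dom h; y \<in> targets S; y \<notin> targets_reaching S h v\<rbrakk> \<Longrightarrow> r v y = r' v y"
  shows "forest_sum S (force h r) = forest_sum S (force h r')"
  unfolding forest_sum_force[OF assms(1,2)]
proof (intro sum.cong prod.cong refl)
  fix f v assume f: "f \<in> {f \<in> forests S. h \<subseteq>\<^sub>m f}" and v: "v \<in> S - dom h"
  have "f v \<notin> targets_reaching S h v"
  proof
    assume "f v \<in> targets_reaching S h v"
    then obtain z where z: "f v = Some z" "(z, v) \<in> (Map.graph h)\<^sup>*"
      by (auto simp: targets_reaching_def)
    moreover have "(Map.graph h)\<^sup>* \<subseteq> (Map.graph f)\<^sup>*" using f by (simp add: graph_mono rtrancl_mono)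
    ultimately show False using f forest_no_back_arc[of f S v z] by auto
  qed
  thus "r v (f v) = r' v (f v)" using f by (auto intro: eq[OF v] forest_value_targets)
qed

lemma forest_sum_force_rooted_tree:
  assumes "finite S" and h: "h \<in> rooted_trees S \<rho>"
  shows "forest_sum S (force h r) = r \<rho> None"
proof -
  have h_forest: "h \<in> forests S" and dom: "dom h = S - {\<rho>}" and \<rho>: "\<rho> \<in> S"
    using h by (auto simp: rooted_trees_def)
  have "f = h" if f: "f \<in> forests S" and le: "h \<subseteq>\<^sub>m f" for f
  proof -
    have "f \<rho> = None"
    proof (rule ccontr)
      assume "f \<rho> \<noteq> None"
      then obtain z where z: "f \<rho> = Some z" "z \<in> S"
        using f by (auto simp: forests_def ran_def)
      hence "(z, \<rho>) \<in> (Map.graph f)\<^sup>*"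
        using rooted_tree_reaches_root[OF assms] rtrancl_mono[OF graph_mono[OF le]] by blast
      thus False using forest_no_back_arc[OF f z(1)] by simp
    qed
    hence "dom f \<subseteq> dom h" using f dom by (auto simp: forests_def)
    thus ?thesis using le by (metis map_le_antisym map_le_def domIff subsetD)
  qed
  hence "{f \<in> forests S. h \<subseteq>\<^sub>m f} = {h}" using h_forest by auto
  moreover have "S - dom h = {\<rho>}" "h \<rho> = None" using dom \<rho> by auto
  ultimately show ?thesis using assms(1) dom by (simp add: forest_sum_force)
qed

section \<open>Vertices with equal rows\<close>

lemma forest_sum_fibres:
  assumes "finite S" "U \<subseteq> S"
  shows "forest_sum S r = (\<Sum>g\<in>{g \<in> forests S. dom g \<inter> U = {}}.
    (\<Prod>x\<in>S - U. r x (g x)) * (\<Sum>f\<in>{f \<in> forests S. f |` (- U) = g}. \<Prod>x\<in>U. r x (f x)))"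
proof -
  let ?G = "{g \<in> forests S. dom g \<inter> U = {}}"
  have prod: "(\<Prod>x\<in>S. r x (f x)) = (\<Prod>x\<in>S - U. r x ((f |` (- U)) x)) * (\<Prod>x\<in>U. r x (f x))" for f
    using prod.subset_diff[OF assms(2,1)] by simp
  have "forest_sum S r =
      (\<Sum>g\<in>?G. \<Sum>f\<in>{f \<in> forests S. f |` (- U) = g}. \<Prod>x\<in>S. r x (f x))"
    unfolding forest_sum_def
    by (rule sum.group[symmetric]) (auto simp: finite_forests[OF assms(1)] forest_restrict)
  thus ?thesis by (simp add: prod sum_distrib_left)
qed

definition linking_pairs :: "'a set \<Rightarrow> 'a \<Rightarrow> 'a \<Rightarrow> ('a \<rightharpoonup> 'a) \<Rightarrow> ('a option \<times> 'a option) set" where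
  "linking_pairs S u v g =
     {(\<alpha>, \<beta>). \<alpha> \<in> targets S \<and> \<beta> \<in> targets S \<and> acyclic (Map.graph (g(u := \<alpha>, v := \<beta>)))}"

lemma bij_betw_linking_pairs:
  assumes "g \<in> forests S" "g u = None" "g v = None" "u \<in> S" "v \<in> S" "u \<noteq> v"
  shows "bij_betw (\<lambda>(\<alpha>, \<beta>). g(u := \<alpha>, v := \<beta>)) (linking_pairs S u v g)
    {f \<in> forests S. f |` (- {u, v}) = g}"
    (is "bij_betw ?extend ?pairs ?extensions")
proof (rule bij_betw_byWitness[where f' = "\<lambda>f. (f u, f v)"])
  have extend: "g(u := f u, v := f v) = f" if "f \<in> ?extensions" for f
    using that by (auto simp: restrict_map_def)
  thus "\<forall>f\<in>?extensions. ?extend (f u, f v) = f" by simp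
  show "\<forall>p\<in>?pairs. (?extend p u, ?extend p v) = p" using assms(6) by auto
  show "(\<lambda>f. (f u, f v)) ` ?extensions \<subseteq> ?pairs"
    using extend by (auto simp: linking_pairs_def forest_value_targets forests_def)
  have "g(u := \<alpha>, v := \<beta>) \<in> ?extensions" if "(\<alpha>, \<beta>) \<in> ?pairs" for \<alpha> \<beta>
  proof -
    have "g(u := \<alpha>, v := \<beta>) \<in> forests S"
      using that assms unfolding forests_def linking_pairs_def
      by (auto simp: ran_def targets_def split: if_splits)
    moreover have "g(u := \<alpha>, v := \<beta>) |` (- {u, v}) = g"
      using assms by (auto simp: restrict_map_def fun_eq_iff)
    ultimately show ?thesis by simp
  qed
  thus "?extend ` ?pairs \<subseteq> ?extensions" by auto
qed

lemma targets_reaching_disjoint: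
  assumes "g u = None" "g v = None" "u \<noteq> v"
  shows "targets_reaching S g u \<inter> targets_reaching S g v = {}"
proof -
  have "z = x" if "g x = None" "(x, z) \<in> (Map.graph g)\<^sup>*" for x z
    using that(2,1) by (cases rule: converse_rtranclE) (auto simp: in_graphD)
  hence False if "(y, u) \<in> (Map.graph g)\<^sup>*" "(y, v) \<in> (Map.graph g)\<^sup>*" for y
    using single_valued_confluent[OF single_valued_graph that] assms by metis
  thus ?thesis by (auto simp: targets_reaching_def)
qed

lemma linking_pairs_eq:
  assumes "u \<in> S" "v \<in> S" "u \<noteq> v" "g \<in> forests S" "g u = None" "g v = None"
  defines "A \<equiv> targets_reaching S g u" and "B \<equiv> targets_reaching S g v"
  defines "R \<equiv> targets S - A - B"
  shows "linking_pairs S u v g = R \<times> R \<union> R \<times> A \<union> B \<times> R"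
proof -
  let ?E = "Map.graph g"
  have "acyclic (Map.graph (g(u := \<alpha>, v := \<beta>))) \<longleftrightarrow> \<alpha> \<notin> A \<and> \<beta> \<notin> B \<and> \<not> (\<beta> \<in> A \<and> \<alpha> \<in> B)"
    if "\<alpha> \<in> targets S" "\<beta> \<in> targets S" for \<alpha> \<beta>
  proof -
    have v: "(g(u := \<alpha>)) v = None" using assms(3,6) by simp
    have graph_u: "Map.graph (g(u := Some a)) = insert (u, a) ?E" for a
      using assms(5) by (simp add: fun_upd_idem)
    have "acyclic ?E" using assms(4) by (simp add: forests_def)
    thus ?thesis
      unfolding acyclic_graph_upd[of "g(u := \<alpha>)" v, OF v] acyclic_graph_upd[of g, OF assms(5)]
      using that assms(1,2,5)
      by (cases \<alpha>; cases \<beta>)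
         (auto simp: graph_u fun_upd_idem rtrancl_insert A_def B_def targets_reaching_def
           targets_def image_iff)
  qed
  hence "linking_pairs S u v g =
      {(\<alpha>, \<beta>). \<alpha> \<in> targets S \<and> \<beta> \<in> targets S \<and> \<alpha> \<notin> A \<and> \<beta> \<notin> B \<and> \<not> (\<beta> \<in> A \<and> \<alpha> \<in> B)}"
    unfolding linking_pairs_def by blast
  also have "\<dots> = R \<times> R \<union> R \<times> A \<union> B \<times> R"
  proof -
    have "A \<inter> B = {}" unfolding A_def B_def using targets_reaching_disjoint assms(3,5,6) by metis
    moreover have "A \<subseteq> targets S" "B \<subseteq> targets S"
      by (simp_all add: A_def B_def targets_reaching_subset)
    ultimately show ?thesis unfolding R_def by blast
  qed
  finally show ?thesis .
qed

text \<open>Since both coordinates carry the same weights, \<open>R \<times> R \<union> R \<times> A \<union> B \<times> R\<close> weighs as much as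
  \<open>R \<times> (R \<union> A \<union> B)\<close>.\<close>

lemma sum_linking_pairs:
  fixes q :: "'a option \<Rightarrow> 'b::comm_semiring_1"
  assumes "finite S" "u \<in> S" "v \<in> S" "u \<noteq> v" "g \<in> forests S" "g u = None" "g v = None"
  shows "(\<Sum>(\<alpha>, \<beta>)\<in>linking_pairs S u v g. q \<alpha> * q \<beta>) =
    sum q (targets S) * (\<Sum>(\<alpha>, \<beta>)\<in>linking_pairs S u v g. forced v \<alpha> * q \<beta>)"
proof -
  define A B where "A = targets_reaching S g u" and "B = targets_reaching S g v"
  define R where "R = targets S - A - B"
  have sub: "A \<subseteq> targets S" "B \<subseteq> targets S"
    by (simp_all add: A_def B_def targets_reaching_subset)
  hence fin: "finite A" "finite B" "finite R"
    using finite_targets[OF assms(1)] by (auto simp: R_def dest: finite_subset)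
  have disj: "A \<inter> B = {}"
    unfolding A_def B_def using targets_reaching_disjoint assms(4,6,7) by metis
  have pairs: "linking_pairs S u v g = R \<times> R \<union> R \<times> A \<union> B \<times> R"
    unfolding R_def A_def B_def using linking_pairs_eq assms(2-7) by metis
  have split: "(\<Sum>(\<alpha>, \<beta>)\<in>linking_pairs S u v g. p \<alpha> * q \<beta>) =
      sum p R * sum q R + sum p R * sum q A + sum p B * sum q R" for p :: "'a option \<Rightarrow> 'b"
    unfolding pairs using fin disj
    by (subst sum.union_disjoint; (subst sum.union_disjoint)?)
       (auto simp: R_def sum_product sum.cartesian_product)
  have "Some v \<in> B" using assms(3) by (auto simp: B_def targets_reaching_def)
  hence "sum (forced v) R = (0::'b)" "sum (forced v) B = (1::'b)"
    using fin by (auto simp: R_def forced_def of_bool_def)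
  moreover have "targets S = R \<union> A \<union> B" using sub by (auto simp: R_def)
  moreover have "R \<inter> A = {}" "(R \<union> A) \<inter> B = {}" using disj by (auto simp: R_def)
  ultimately have "sum q (targets S) = sum q R + sum q A + sum q B"
    and "sum (forced v) R = (0::'b)" "sum (forced v) B = (1::'b)"
    using fin by (simp_all add: sum.union_disjoint)
  thus ?thesis unfolding split by (simp add: algebra_simps)
qed

lemma forest_sum_twins:
  fixes r :: "('a, 'b::comm_semiring_1) rows"
  assumes "finite S" "u \<in> S" "v \<in> S" "u \<noteq> v" "r u = r v"
  shows "forest_sum S r = sum (r v) (targets S) * forest_sum S (force [u \<mapsto> v] r)"
proof -
  let ?r = "force [u \<mapsto> v] r" and ?extensions = "\<lambda>g. {f \<in> forests S. f |` (- {u, v}) = g}"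
  have "(\<Prod>x\<in>S - {u, v}. r x (g x)) * (\<Sum>f\<in>?extensions g. \<Prod>x\<in>{u, v}. r x (f x)) =
      sum (r v) (targets S) *
      ((\<Prod>x\<in>S - {u, v}. ?r x (g x)) * (\<Sum>f\<in>?extensions g. \<Prod>x\<in>{u, v}. ?r x (f x)))"
    if "g \<in> {g \<in> forests S. dom g \<inter> {u, v} = {}}" for g
  proof -
    have g: "g \<in> forests S" "g u = None" "g v = None" using that by auto
    have extend: "(\<Sum>f\<in>?extensions g. \<Prod>x\<in>{u, v}. q x (f x)) =
        (\<Sum>(\<alpha>, \<beta>)\<in>linking_pairs S u v g. q u \<alpha> * q v \<beta>)" for q :: "('a, 'b) rows"
      using assms(4) bij_betw_linking_pairs[OF g assms(2-4)]
      by (simp add: case_prod_unfold flip: sum.reindex_bij_betw)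
    have "(\<Prod>x\<in>S - {u, v}. ?r x (g x)) = (\<Prod>x\<in>S - {u, v}. r x (g x))"
      by (rule prod.cong) (auto simp: force_def)
    moreover have "(\<Sum>f\<in>?extensions g. \<Prod>x\<in>{u, v}. r x (f x)) =
        sum (r v) (targets S) * (\<Sum>f\<in>?extensions g. \<Prod>x\<in>{u, v}. ?r x (f x))"
      unfolding extend[of r] extend[of ?r]
      using sum_linking_pairs[OF assms(1-4) g, of "r v"] assms(4,5) by (simp add: force_def)
    ultimately show ?thesis by (simp only: mult.left_commute)
  qed
  thus ?thesis
    using assms(2,3) by (simp add: forest_sum_fibres[of S "{u, v}", OF assms(1)] sum_distrib_left)
qed

lemma forest_sum_twin_class:
  assumes "finite S" "K \<subseteq> S" "v \<in> S" "v \<notin> K" "\<And>x. x \<in> K \<Longrightarrow> r x = r v"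
  shows "forest_sum S r =
    sum (r v) (targets S) ^ card K * forest_sum S (force ((\<lambda>_. Some v) |` K) r)"
proof -
  have "finite K" using assms(1,2) finite_subset by blast
  thus ?thesis using assms(2,4,5)
  proof (induction K)
    case empty
    show ?case by (simp add: force_empty)
  next
    case (insert k K)
    let ?r = "force ((\<lambda>_. Some v) |` K) r"
    have "forest_sum S r = sum (r v) (targets S) ^ card K * forest_sum S ?r"
      using insert by simp
    also have "forest_sum S ?r = sum (r v) (targets S) * forest_sum S (force [k \<mapsto> v] ?r)"
      using forest_sum_twins[of S k v ?r] insert assms(1,3) by (auto simp: force_def)
    also have "force [k \<mapsto> v] ?r = force ((\<lambda>_. Some v) |` insert k K) r"
      by (auto simp: fun_eq_iff force_def restrict_map_def)
    finally show ?case using insert.hyps by (simp add: ac_simps)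
  qed
qed

lemma forest_sum_force_twins:
  assumes "finite S" "dom h \<subseteq> S" "K \<subseteq> S" "v \<in> S" "v \<notin> K" "dom h \<inter> insert v K = {}"
    and twins: "\<And>x y. \<lbrakk>x \<in> K; y \<in> targets S; y \<notin> targets_reaching S h x\<rbrakk> \<Longrightarrow> r x y = r v y"
  shows "forest_sum S (force h r) =
    sum (r v) (targets S) ^ card K * forest_sum S (force (h ++ (\<lambda>_. Some v) |` K) r)"
proof -
  let ?k = "(\<lambda>_. Some v) |` K" and ?r = "\<lambda>x. if x \<in> K then r v else r x"
  have none: "h x = None" if "x \<in> insert v K" for x using that assms(6) by blast
  have "forest_sum S (force h r) = forest_sum S (force h ?r)"
    using twins by (intro forest_sum_force_cong[OF assms(1,2)]) auto
  also have "\<dots> = sum (r v) (targets S) ^ card K * forest_sum S (force ?k (force h ?r))"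
    using forest_sum_twin_class[OF assms(1,3-5), of "force h ?r"] none assms(5)
    by (simp add: force_def)
  also have "force ?k (force h ?r) = force (h ++ ?k) r"
    unfolding force_map_add by (simp add: fun_eq_iff force_def restrict_map_def)
  finally show ?thesis .
qed

section \<open>Sources\<close>

lemma forest_upd_source:
  assumes "g \<in> forests S" "\<alpha> \<in> targets S" "u \<notin> S"
  shows "g(u := \<alpha>) \<in> forests (insert u S)" "u \<notin> ran (g(u := \<alpha>))"
proof -
  have g: "g u = None" "dom g \<subseteq> S" "ran g \<subseteq> S" "acyclic (Map.graph g)"
    using assms(1,3) by (auto simp: forests_def)
  have "(a, u) \<notin> (Map.graph g)\<^sup>*" if "a \<in> S" for a
  proof
    assume "(a, u) \<in> (Map.graph g)\<^sup>*"
    thus False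
    proof (cases rule: rtranclE)
      case (step y)
      hence "u \<in> ran g" by (metis graph_ranD snd_conv)
      thus False using g(3) assms(3) by blast
    qed (use that assms(3) in simp)
  qed
  hence "acyclic (Map.graph (g(u := \<alpha>)))"
    using g(4) assms(2) unfolding acyclic_graph_upd[of g, OF g(1)] by (auto simp: targets_def)
  moreover have "ran (g(u := \<alpha>)) \<subseteq> S"
    using g(3) assms(2) by (auto simp: ran_def targets_def split: if_splits)
  ultimately show "g(u := \<alpha>) \<in> forests (insert u S)" "u \<notin> ran (g(u := \<alpha>))"
    using g(2) assms(3) by (auto simp: forests_def)
qed

lemma bij_betw_forest_upd_source:
  assumes "u \<notin> S"
  shows "bij_betw (\<lambda>(\<alpha>, g). g(u := \<alpha>)) (targets S \<times> forests S)
    {f \<in> forests (insert u S). u \<notin> ran f}"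
    (is "bij_betw ?extend ?pairs ?extensions")
proof (rule bij_betw_byWitness[where f' = "\<lambda>f. (f u, f(u := None))"])
  have "g u = None" if "g \<in> forests S" for g using that assms by (auto simp: forests_def)
  thus "\<forall>p\<in>?pairs. (?extend p u, (?extend p)(u := None)) = p" by (auto simp: fun_upd_idem)
  show "\<forall>f\<in>?extensions. ?extend (f u, f(u := None)) = f" by simp
  show "?extend ` ?pairs \<subseteq> ?extensions"
    by (auto simp: forest_upd_source assms simp del: ran_map_upd)
  have "(f u, f(u := None)) \<in> ?pairs" if f: "f \<in> forests (insert u S)" "u \<notin> ran f" for f
  proof -
    have "f(u := None) = f |` (- {u})" by (auto simp: restrict_map_def)
    hence "f(u := None) \<in> forests (insert u S)" using forest_restrict[OF f(1)] by simp
    moreover have "ran (f(u := None)) \<subseteq> ran f" by (auto simp: ran_def)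
    ultimately have "f(u := None) \<in> forests S" using f(2) by (auto simp: forests_def)
    moreover have "f u \<in> targets S"
      using forest_value_targets[OF f(1), of u] f(2) by (auto simp: targets_def ran_def)
    ultimately show ?thesis by simp
  qed
  thus "(\<lambda>f. (f u, f(u := None))) ` ?extensions \<subseteq> ?pairs" by auto
qed

lemma forest_sum_source:
  assumes "finite S" "u \<notin> S" and source: "\<And>v. v \<in> insert u S \<Longrightarrow> r v (Some u) = 0"
  shows "forest_sum (insert u S) r = sum (r u) (targets S) * forest_sum S r"
proof -
  have "(\<Prod>v\<in>insert u S. r v (f v)) = 0" if f: "f \<in> forests (insert u S)" and "u \<in> ran f" for f
  proof -
    obtain v where v: "f v = Some u" using \<open>u \<in> ran f\<close> by (auto simp: ran_def)
    hence "v \<in> insert u S" using f by (auto simp: forests_def)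
    moreover from this have "r v (f v) = 0" using source v by simp
    ultimately show ?thesis using assms(1) by (intro prod_zero) auto
  qed
  hence "forest_sum (insert u S) r =
      (\<Sum>f\<in>{f \<in> forests (insert u S). u \<notin> ran f}. \<Prod>v\<in>insert u S. r v (f v))"
    unfolding forest_sum_def by (intro sum.mono_neutral_right) (auto simp: finite_forests assms(1))
  also have "\<dots> = (\<Sum>(\<alpha>, g)\<in>targets S \<times> forests S. \<Prod>v\<in>insert u S. r v ((g(u := \<alpha>)) v))"
    using bij_betw_forest_upd_source[OF assms(2)]
    by (simp add: case_prod_unfold flip: sum.reindex_bij_betw)
  also have "\<dots> = (\<Sum>(\<alpha>, g)\<in>targets S \<times> forests S. r u \<alpha> * (\<Prod>v\<in>S. r v (g v)))"
  proof -
    have "(\<Prod>v\<in>S. r v ((g(u := \<alpha>)) v)) = (\<Prod>v\<in>S. r v (g v))" for g \<alpha>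
      using assms(2) by (intro prod.cong) auto
    thus ?thesis using assms(1,2) by simp
  qed
  finally show ?thesis
    unfolding forest_sum_def sum_product sum.cartesian_product .
qed

lemma forest_sum_sources:
  assumes "finite A" "finite S" "A \<inter> S = {}"
    and "\<And>u v. \<lbrakk>u \<in> A; v \<in> A \<union> S\<rbrakk> \<Longrightarrow> r v (Some u) = 0"
  shows "forest_sum (A \<union> S) r = (\<Prod>u\<in>A. sum (r u) (targets S)) * forest_sum S r"
  using assms
proof (induction A)
  case (insert u A)
  have "forest_sum (insert u A \<union> S) r = sum (r u) (targets (A \<union> S)) * forest_sum (A \<union> S) r"
    unfolding Un_insert_left
    using insert.hyps insert.prems by (intro forest_sum_source) auto
  also have "forest_sum (A \<union> S) r = (\<Prod>u\<in>A. sum (r u) (targets S)) * forest_sum S r"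
    using insert.prems by (intro insert.IH) auto
  also have "sum (r u) (targets (A \<union> S)) = sum (r u) (targets S)"
    using insert.hyps insert.prems
    by (intro sum.mono_neutral_right) (auto simp: targets_def)
  finally show ?case using insert.hyps by (simp add: ac_simps)
qed simp

section \<open>Spanning trees\<close>

definition arc_edges :: "('a \<rightharpoonup> 'a) \<Rightarrow> 'a set set" where
  "arc_edges f = {{x, y} |x y. f x = Some y}"

definition rooted_spanning_trees :: "'a set \<Rightarrow> 'a set set \<Rightarrow> 'a \<Rightarrow> ('a \<rightharpoonup> 'a) set" where
  "rooted_spanning_trees V E \<rho> = {f \<in> rooted_trees V \<rho>. arc_edges f \<subseteq> E}"

lemma rooted_tree_iff_card_roots:
  assumes "f \<in> forests S"
  shows "(\<exists>\<rho>. f \<in> rooted_trees S \<rho>) \<longleftrightarrow> card (S - dom f) = 1"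
proof -
  have "dom f \<subseteq> S" using assms by (simp add: forests_def)
  hence "S - dom f = {\<rho>} \<longleftrightarrow> \<rho> \<in> S \<and> dom f = S - {\<rho>}" for \<rho> by blast
  thus ?thesis using assms by (simp add: card_1_singleton_iff rooted_trees_def)
qed

lemma forest_no_2cycle: "\<lbrakk>f \<in> forests S; f x = Some y\<rbrakk> \<Longrightarrow> f y \<noteq> Some x"
  using forest_no_back_arc[of f S x y] by (auto simp: in_graphI)

lemma card_arc_edges:
  assumes "f \<in> forests S"
  shows "card (arc_edges f) = card (dom f)"
proof -
  have "arc_edges f = (\<lambda>x. {x, the (f x)}) ` dom f"
    by (force simp: arc_edges_def)
  moreover have "inj_on (\<lambda>x. {x, the (f x)}) (dom f)"
    using forest_no_2cycle[OF assms] by (fastforce simp: inj_on_def doubleton_eq_iff)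
  ultimately show ?thesis by (simp add: card_image)
qed

lemma arc_edges_spanning_tree:
  assumes "finite V" "f \<in> rooted_spanning_trees V E \<rho>"
  shows "arc_edges f \<in> spanning_trees V E"
proof -
  have f: "f \<in> rooted_trees V \<rho>" "f \<in> forests V" "dom f = V - {\<rho>}" "\<rho> \<in> V" "arc_edges f \<subseteq> E"
    using assms by (auto simp: rooted_spanning_trees_def rooted_trees_def)
  let ?R = "{(x, y). {x, y} \<in> arc_edges f}"
  have "Map.graph f \<subseteq> ?R" by (auto simp: Map.graph_def arc_edges_def)
  hence to_root: "(x, \<rho>) \<in> ?R\<^sup>*" if "x \<in> V" for x
    using rooted_tree_reaches_root[OF assms(1) f(1) that] rtrancl_mono by blast
  have "sym (?R\<^sup>*)" by (intro sym_rtrancl) (auto simp: sym_def insert_commute)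
  hence "(u, v) \<in> ?R\<^sup>*" if "u \<in> V" "v \<in> V" for u v
    using to_root[OF that(1)] symD[OF _ to_root[OF that(2)]] rtrancl_trans by fast
  hence "connected_graph V (arc_edges f)"
    using f(4) by (auto simp: connected_graph_def)
  moreover have "card (arc_edges f) = card V - 1"
    using card_arc_edges[OF f(2)] f(3,4) assms(1) by simp
  ultimately show ?thesis using f(5) by (simp add: spanning_trees_def)
qed

text \<open>If \<open>f v \<noteq> g v\<close>, then the edge of \<open>g\<close> at \<open>v\<close> must be traversed by \<open>f\<close> in the opposite
  direction, so \<open>f\<close> and \<open>g\<close> also differ at \<open>g v\<close>; hence they differ all the way up to the root.\<close>

lemma inj_on_arc_edges:
  assumes "finite V"
  shows "inj_on arc_edges (rooted_trees V \<rho>)"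
proof (rule inj_onI)
  fix f g assume f: "f \<in> rooted_trees V \<rho>" and g: "g \<in> rooted_trees V \<rho>"
    and eq: "arc_edges f = arc_edges g"
  have dom: "dom f = V - {\<rho>}" "dom g = V - {\<rho>}" and g_forest: "g \<in> forests V"
    using f g by (simp_all add: rooted_trees_def)
  have "f v = g v" if "(v, \<rho>) \<in> (Map.graph g)\<^sup>*" for v
    using that
  proof (induction rule: converse_rtrancl_induct)
    case base
    show ?case using dom by (metis Diff_iff domIff singletonI)
  next
    case (step v u)
    hence gv: "g v = Some u" by (simp add: in_graphD)
    hence "{v, u} \<in> arc_edges f" unfolding eq by (auto simp: arc_edges_def)
    then obtain a b where ab: "f a = Some b" "{v, u} = {a, b}" by (auto simp: arc_edges_def)
    have "f u \<noteq> Some v" using step.IH forest_no_2cycle[OF g_forest gv] by simp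
    thus ?case using ab gv by (auto simp: doubleton_eq_iff)
  qed
  hence "f v = g v" if "v \<in> V" for v
    using rooted_tree_reaches_root[OF assms g that] by blast
  moreover have "f v = g v" if "v \<notin> V" for v
    using that dom by (metis Diff_iff domIff)
  ultimately show "f = g" by blast
qed

lemma connected_graph_obtains_rooted_spanning_tree:
  assumes "\<rho> \<in> V" "connected_graph V F" "\<And>e. e \<in> F \<Longrightarrow> e \<subseteq> V"
  obtains f where "f \<in> rooted_spanning_trees V F \<rho>"
proof -
  let ?R = "{(x, y). {x, y} \<in> F}"
  obtain d :: "'a \<Rightarrow> nat"
    where "\<And>v. \<lbrakk>(v, \<rho>) \<in> ?R\<^sup>*; v \<noteq> \<rho>\<rbrakk> \<Longrightarrow> \<exists>y. (v, y) \<in> ?R \<and> d y < d v"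
    using rtrancl_descent by metis
  hence "\<forall>v\<in>V - {\<rho>}. \<exists>y. {v, y} \<in> F \<and> d y < d v"
    using assms(1,2) by (simp add: connected_graph_def)
  then obtain p where p: "\<forall>v\<in>V - {\<rho>}. {v, p v} \<in> F \<and> d (p v) < d v"
    by (rule bchoice[THEN exE])
  define f where "f v = (if v \<in> V - {\<rho>} then Some (p v) else None)" for v
  have f: "v \<in> V - {\<rho>}" "{v, y} \<in> F" "d y < d v" if "f v = Some y" for v y
    using that p by (auto simp: f_def split: if_splits)
  have "acyclic (Map.graph f)"
    using f(3) by (intro acyclicI_order[where f = d]) (auto dest: in_graphD)
  moreover have "ran f \<subseteq> V" using f(2) assms(3) by (auto simp: ran_def)
  moreover have "dom f = V - {\<rho>}" by (auto simp: f_def split: if_splits)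
  moreover have "arc_edges f \<subseteq> F" using f(2) by (auto simp: arc_edges_def)
  ultimately have "f \<in> rooted_spanning_trees V F \<rho>"
    using assms(1) by (auto simp: rooted_spanning_trees_def rooted_trees_def forests_def)
  thus thesis by (rule that)
qed

lemma card_rooted_spanning_trees:
  assumes "simple_graph V E" "\<rho> \<in> V"
  shows "card (rooted_spanning_trees V E \<rho>) = card (spanning_trees V E)"
proof -
  have fin: "finite V" and E: "\<And>e. e \<in> E \<Longrightarrow> e \<subseteq> V"
    using assms(1) by (auto simp: simple_graph_def)
  have "F \<in> arc_edges ` rooted_spanning_trees V E \<rho>" if "F \<in> spanning_trees V E" for F
  proof -
    have F: "F \<subseteq> E" "connected_graph V F" "card F = card V - 1"
      using that by (auto simp: spanning_trees_def)
    hence "finite F" using E fin by (meson finite_Pow_iff finite_subset Pow_iff subsetI)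
    obtain f where f: "f \<in> rooted_spanning_trees V F \<rho>"
      using connected_graph_obtains_rooted_spanning_tree[OF assms(2) F(2)] E F(1) by blast
    hence "arc_edges f \<in> spanning_trees V F" by (rule arc_edges_spanning_tree[OF fin])
    hence "arc_edges f = F"
      using F(3) \<open>finite F\<close> by (intro card_subset_eq) (auto simp: spanning_trees_def)
    moreover have "f \<in> rooted_spanning_trees V E \<rho>"
      using f F(1) by (auto simp: rooted_spanning_trees_def)
    ultimately show ?thesis by blast
  qed
  hence "arc_edges ` rooted_spanning_trees V E \<rho> = spanning_trees V E"
    using arc_edges_spanning_tree[OF fin] by blast
  moreover have "inj_on arc_edges (rooted_spanning_trees V E \<rho>)"
    using inj_on_arc_edges[OF fin] by (rule inj_on_subset) (auto simp: rooted_spanning_trees_def)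
  ultimately show ?thesis by (metis card_image)
qed

definition adjacency_row :: "'a set set \<Rightarrow> 'b::comm_semiring_1 \<Rightarrow> ('a, 'b) rows" where
  "adjacency_row E X u y = (case y of None \<Rightarrow> X | Some x \<Rightarrow> of_bool ({u, x} \<in> E))"

lemma prod_adjacency_row:
  assumes "finite V" "f \<in> forests V"
  shows "(\<Prod>v\<in>V. adjacency_row E X v (f v)) =
    (if arc_edges f \<subseteq> E then X ^ card (V - dom f) else 0)"
proof (cases "arc_edges f \<subseteq> E")
  case True
  hence "(\<Prod>v\<in>V. adjacency_row E X v (f v)) = (\<Prod>v\<in>V. if v \<in> V - dom f then X else 1)"
    by (intro prod.cong) (auto simp: adjacency_row_def arc_edges_def split: option.splits)
  thus ?thesis using True assms(1) by (simp add: prod.If_cases set_diff_eq Int_def)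
next
  case False
  then obtain x y where "f x = Some y" "{x, y} \<notin> E" by (auto simp: arc_edges_def)
  moreover from this have "x \<in> V" using assms(2) by (auto simp: forests_def)
  ultimately have "(\<Prod>v\<in>V. adjacency_row E X v (f v)) = 0"
    using assms(1) by (intro prod_zero) (auto simp: adjacency_row_def intro!: bexI[of _ x])
  thus ?thesis using False by simp
qed

lemma coeff_forest_sum_adjacency_row:
  assumes "simple_graph V E"
  shows "coeff (forest_sum V (adjacency_row E [:0, 1::'b::comm_semiring_1:])) 1 =
    of_nat (card V * card (spanning_trees V E))"
proof -
  have fin: "finite V" "finite (forests V)"
    using assms finite_forests by (auto simp: simple_graph_def)
  have tree: "(\<exists>\<rho>\<in>V. f \<in> rooted_spanning_trees V E \<rho>) \<longleftrightarrow>
      arc_edges f \<subseteq> E \<and> card (V - dom f) = 1" if "f \<in> forests V" for f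
    unfolding rooted_tree_iff_card_roots[OF that, symmetric]
    by (auto simp: rooted_spanning_trees_def rooted_trees_def)
  have pow: "[:0, 1::'b:] ^ m = monom 1 m" for m
    by (simp only: monom_altdef smult_1_left)
  have "coeff (forest_sum V (adjacency_row E [:0, 1::'b:])) 1 =
      (\<Sum>f\<in>forests V. of_bool (\<exists>\<rho>\<in>V. f \<in> rooted_spanning_trees V E \<rho>))"
    unfolding forest_sum_def coeff_sum
    by (rule sum.cong) (simp_all add: prod_adjacency_row fin tree pow)
  also have "\<dots> = of_nat (card (\<Union>\<rho>\<in>V. rooted_spanning_trees V E \<rho>))"
  proof -
    have "(\<Union>\<rho>\<in>V. rooted_spanning_trees V E \<rho>) =
        forests V \<inter> {f. \<exists>\<rho>\<in>V. f \<in> rooted_spanning_trees V E \<rho>}"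
      by (auto simp: rooted_spanning_trees_def rooted_trees_def)
    thus ?thesis using fin(2) by simp
  qed
  also have "card (\<Union>\<rho>\<in>V. rooted_spanning_trees V E \<rho>) =
      (\<Sum>\<rho>\<in>V. card (rooted_spanning_trees V E \<rho>))"
    using fin by (intro card_UN_disjoint) (auto simp: rooted_spanning_trees_def rooted_trees_def)
  also have "\<dots> = card V * card (spanning_trees V E)"
    using card_rooted_spanning_trees[OF assms] by simp
  finally show ?thesis .
qed

section \<open>Cotrees\<close>

lemma tree_childrenD:
  assumes "c \<in> tree_children T w"
  shows "(c, w) \<in> parent_rel T" "tparent T c = w"
  using assms by (auto simp: tree_children_def parent_rel_def)

lemma is_ancestor_refl: "is_ancestor T x x"
  by (simp add: is_ancestor_def)

lemma is_ancestor_child: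
  assumes "c \<in> tree_children T w"
  shows "is_ancestor T a c \<longleftrightarrow> a = c \<or> is_ancestor T a w"
  using tree_childrenD[OF assms]
  by (auto simp: is_ancestor_def parent_rel_def elim: converse_rtranclE
      intro: converse_rtrancl_into_rtrancl)

lemma is_ancestor_leaf: "\<lbrakk>is_ancestor T x y; x \<in> tree_leaves T\<rbrakk> \<Longrightarrow> y = x"
  by (auto simp: is_ancestor_def tree_leaves_def tree_children_def elim: rtranclE)

lemma lca_cong:
  assumes "\<And>a. is_ancestor T a x \<and> is_ancestor T a y \<longleftrightarrow> is_ancestor T a x' \<and> is_ancestor T a y'"
  shows "lca T x y = lca T x' y'"
  unfolding lca_def conj_assoc[symmetric] assms ..

definition parent_map :: "'a cotree \<Rightarrow> 'a \<rightharpoonup> 'a" where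
  "parent_map T x = (if x \<in> tnodes T - {troot T} then Some (tparent T x) else None)"

lemma parent_map_eq_Some_iff: "parent_map T x = Some w \<longleftrightarrow> x \<in> tree_children T w"
  by (auto simp: parent_map_def tree_children_def parent_rel_def)

lemma graph_parent_map: "Map.graph (parent_map T) = parent_rel T"
  by (auto simp: Map.graph_def parent_map_eq_Some_iff tree_children_def)

locale rooted_cotree =
  fixes T :: "'a cotree"
  assumes rooted: "rooted_tree T"
begin

lemma finite_nodes: "finite (tnodes T)"
  using rooted by (simp add: rooted_tree_def)

lemma root_in_nodes: "troot T \<in> tnodes T"
  using rooted by (simp add: rooted_tree_def)

lemma parent_rel_subset_nodes: "parent_rel T \<subseteq> tnodes T \<times> tnodes T"
  using rooted by (simp add: rooted_tree_def)

lemma is_ancestor_root: "x \<in> tnodes T \<Longrightarrow> is_ancestor T (troot T) x"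
  using rooted by (simp add: rooted_tree_def is_ancestor_def)

lemma children_subset_nodes: "tree_children T w \<subseteq> tnodes T"
  using parent_rel_subset_nodes by (auto simp: tree_children_def)

lemma leaves_subset_nodes: "tree_leaves T \<subseteq> tnodes T"
  by (auto simp: tree_leaves_def)

lemma nodes_eq: "tnodes T = interior_nodes T \<union> tree_leaves T"
  using leaves_subset_nodes by (auto simp: interior_nodes_def)

lemma finite_leaves: "finite (tree_leaves T)"
  using leaves_subset_nodes finite_nodes by (rule finite_subset)

lemma finite_children: "finite (tree_children T w)"
  using children_subset_nodes finite_nodes by (rule finite_subset)

lemma acyclic_parent_rel: "acyclic (parent_rel T)"
proof (rule acyclic_if_reaches_sink)
  show "single_valued (parent_rel T)" by (auto simp: single_valued_def parent_rel_def)
  show "troot T \<notin> Domain (parent_rel T)" by (auto simp: parent_rel_def)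
  show "(x, troot T) \<in> (parent_rel T)\<^sup>*" if "x \<in> Domain (parent_rel T)" for x
    using that parent_rel_subset_nodes is_ancestor_root by (auto simp: is_ancestor_def)
qed

lemma is_ancestor_antisym: "\<lbrakk>is_ancestor T x y; is_ancestor T y x\<rbrakk> \<Longrightarrow> x = y"
  unfolding is_ancestor_def using acyclic_parent_rel
  by (metis acyclic_def rtranclD rtrancl_trancl_trancl)

lemma lca_ancestor: "is_ancestor T z x \<Longrightarrow> lca T x z = z"
  unfolding lca_def
  by (rule the_equality) (auto intro: is_ancestor_refl is_ancestor_antisym)

lemma parent_map_rooted_tree: "parent_map T \<in> rooted_trees (tnodes T) (troot T)"
proof -
  have "ran (parent_map T) \<subseteq> tnodes T"
    using parent_rel_subset_nodes by (auto simp: ran_def parent_map_eq_Some_iff tree_children_def)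
  moreover have "dom (parent_map T) = tnodes T - {troot T}"
    by (auto simp: parent_map_def split: if_splits)
  ultimately show ?thesis
    using acyclic_parent_rel root_in_nodes
    by (auto simp: rooted_trees_def forests_def graph_parent_map)
qed

lemma leaf_is_child:
  assumes "x \<in> tree_leaves T" "y \<in> tnodes T" "y \<noteq> x"
  shows "x \<in> tree_children T (tparent T x)"
proof -
  have "x \<noteq> troot T" using is_ancestor_leaf[of T x y] is_ancestor_root[of y] assms by auto
  thus ?thesis using assms(1) leaves_subset_nodes by (auto simp: tree_children_def parent_rel_def)
qed

lemma lca_leaves_eq_lca_parent:
  assumes "u \<in> tree_leaves T" "x \<in> tree_leaves T" "u \<noteq> x"
  shows "lca T u x = lca T (tparent T x) u"
proof (rule lca_cong)
  have "x \<in> tree_children T (tparent T x)"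
    using leaf_is_child[of x u] assms leaves_subset_nodes by auto
  moreover have "\<not> is_ancestor T x u" using is_ancestor_leaf[of T x u] assms by auto
  ultimately show "is_ancestor T a u \<and> is_ancestor T a x \<longleftrightarrow>
      is_ancestor T a (tparent T x) \<and> is_ancestor T a u" for a
    using is_ancestor_child by metis
qed

lemma lca_child_eq_lca_parent:
  assumes "c \<in> tree_children T w" "x \<in> tree_leaves T" "\<not> is_ancestor T c x"
  shows "lca T (tparent T x) c = lca T (tparent T x) w"
proof (rule lca_cong)
  have "c \<noteq> x" using assms(3) is_ancestor_refl by metis
  hence "x \<in> tree_children T (tparent T x)"
    using leaf_is_child[of x c] assms(1,2) children_subset_nodes by auto
  hence "\<not> is_ancestor T c (tparent T x)" using is_ancestor_child assms(3) by metis
  thus "is_ancestor T a (tparent T x) \<and> is_ancestor T a c \<longleftrightarrow>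
      is_ancestor T a (tparent T x) \<and> is_ancestor T a w" for a
    using is_ancestor_child[OF assms(1)] by metis
qed

lemma interior_degree_root:
  assumes "troot T \<in> interior_nodes T" "tlabel T (troot T) = JoinNode"
  shows "interior_degree T (troot T) = card (tree_leaves T)"
proof -
  have "tlabel T (lca T (tparent T v) (troot T)) = JoinNode" if v: "v \<in> tree_leaves T" for v
  proof -
    have "v \<noteq> troot T" using v assms(1) by (auto simp: interior_nodes_def)
    hence "v \<in> tree_children T (tparent T v)" using leaf_is_child[OF v root_in_nodes] by simp
    hence "tparent T v \<in> tnodes T"
      using parent_rel_subset_nodes by (auto simp: tree_children_def)
    thus ?thesis using assms(2) lca_ancestor[OF is_ancestor_root] by simp
  qed
  hence "{v \<in> tree_leaves T. tlabel T (lca T (tparent T v) (troot T)) = JoinNode} = tree_leaves T"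
    by blast
  thus ?thesis by (simp add: interior_degree_def)
qed

lemma num_interior_children_plus_num_leaf_children:
  "num_interior_children T w + num_leaf_children T w = card (tree_children T w)"
proof -
  have "tree_children T w =
      (tree_children T w \<inter> interior_nodes T) \<union> (tree_children T w \<inter> tree_leaves T)"
    using children_subset_nodes nodes_eq by blast
  moreover have "(tree_children T w \<inter> interior_nodes T) \<inter> (tree_children T w \<inter> tree_leaves T) = {}"
    by (auto simp: interior_nodes_def)
  ultimately show ?thesis
    unfolding num_interior_children_def num_leaf_children_def
    by (metis card_Un_disjoint finite_Int finite_children)
qed

lemma root_not_interiorD:
  assumes "troot T \<notin> interior_nodes T"
  shows "interior_nodes T = {}" "tree_leaves T = {troot T}"
proof -
  have root: "troot T \<in> tree_leaves T" using assms root_in_nodes nodes_eq by blast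
  have "tnodes T \<subseteq> {troot T}"
    by (rule subsetI) (simp add: is_ancestor_leaf[OF is_ancestor_root root])
  thus "interior_nodes T = {}" "tree_leaves T = {troot T}"
    using assms root nodes_eq by auto
qed

end

section \<open>Forests on the nodes of the cotree\<close>

text \<open>The entry of a leaf at itself need not match its adjacency row, but a forest has no loops.\<close>

definition link_row :: "'a cotree \<Rightarrow> 'b::comm_semiring_1 \<Rightarrow> ('a, 'b) rows" where
  "link_row T X z y = (case y of None \<Rightarrow> X
     | Some x \<Rightarrow> of_bool (x \<in> tree_leaves T \<and> tlabel T (lca T (tparent T x) z) = JoinNode))"

definition children_closed :: "'a cotree \<Rightarrow> 'a set \<Rightarrow> bool" where
  "children_closed T U \<longleftrightarrow> U \<subseteq> tnodes T \<and> (\<forall>z\<in>U. tree_children T z \<subseteq> U)"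

definition arcs_into :: "'a cotree \<Rightarrow> 'a set \<Rightarrow> 'a \<rightharpoonup> 'a" where
  "arcs_into T U = parent_map T |` (\<Union>z\<in>U. tree_children T z)"

lemma arcs_into_eq_Some_iff: "arcs_into T U x = Some w \<longleftrightarrow> w \<in> U \<and> x \<in> tree_children T w"
  by (auto simp: arcs_into_def restrict_map_def parent_map_eq_Some_iff dest: tree_childrenD(2))

lemma dom_arcs_into: "dom (arcs_into T U) = (\<Union>z\<in>U. tree_children T z)"
  by (auto simp: dom_def arcs_into_eq_Some_iff)

lemma arcs_into_insert:
  "arcs_into T (insert w U) = arcs_into T U ++ (\<lambda>_. Some w) |` tree_children T w"
  by (auto simp: fun_eq_iff arcs_into_def restrict_map_def map_add_def parent_map_eq_Some_iff)

context rooted_cotree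
begin

lemma sum_link_row:
  assumes "tree_leaves T \<subseteq> S" "finite S"
  shows "sum (link_row T X z) (targets S) = X + of_nat (interior_degree T z)"
  using assms
  by (simp add: targets_def sum.reindex link_row_def interior_degree_def Collect_conj_eq
      Int_assoc[symmetric] Int_absorb1)

lemma descendant_reaches_by_arcs_into:
  assumes "children_closed T U" "c \<in> U" "is_ancestor T c x"
  shows "x \<in> U \<and> (x, c) \<in> (Map.graph (arcs_into T U))\<^sup>*"
  using assms(3) unfolding is_ancestor_def
proof (induction rule: converse_rtrancl_induct)
  case (step x y)
  hence "x \<in> tree_children T y" by (simp add: tree_children_def)
  moreover from this have "(x, y) \<in> Map.graph (arcs_into T U)"
    using step.IH by (simp add: in_graphI arcs_into_eq_Some_iff)
  ultimately show ?case
    using step.IH assms(1) by (auto simp: children_closed_def intro: converse_rtrancl_into_rtrancl)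
qed (simp add: assms(2))

lemma forest_sum_arcs_into_insert:
  assumes "children_closed T U" "w \<in> tnodes T - U" "tree_children T w \<subseteq> U"
  shows "forest_sum (tnodes T) (force (arcs_into T U) (link_row T X)) =
    (X + of_nat (interior_degree T w)) ^ card (tree_children T w) *
    forest_sum (tnodes T) (force (arcs_into T (insert w U)) (link_row T X))"
proof -
  let ?C = "tree_children T w"
  have "forest_sum (tnodes T) (force (arcs_into T U) (link_row T X)) =
      sum (link_row T X w) (targets (tnodes T)) ^ card ?C *
      forest_sum (tnodes T) (force (arcs_into T U ++ (\<lambda>_. Some w) |` ?C) (link_row T X))"
  proof (rule forest_sum_force_twins)
    show "dom (arcs_into T U) \<inter> insert w ?C = {}"
      using assms by (auto simp: dom_arcs_into children_closed_def dest: tree_childrenD(2))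
    show "link_row T X c y = link_row T X w y"
      if "c \<in> ?C" "y \<in> targets (tnodes T)"
        "y \<notin> targets_reaching (tnodes T) (arcs_into T U) c" for c y
    proof (cases y)
      case (Some x)
      hence "\<not> is_ancestor T c x"
        using that assms(3) descendant_reaches_by_arcs_into[OF assms(1)]
        by (auto simp: targets_reaching_def targets_def)
      thus ?thesis using Some lca_child_eq_lca_parent[OF that(1)] by (auto simp: link_row_def)
    qed (simp add: link_row_def)
  qed (use assms finite_nodes children_subset_nodes in \<open>auto simp: dom_arcs_into\<close>)
  thus ?thesis
    by (simp add: sum_link_row leaves_subset_nodes finite_nodes arcs_into_insert)
qed

lemma children_closed_remove_top:
  assumes "children_closed T U" "U \<noteq> {}"
  obtains w where "w \<in> U" "children_closed T (U - {w})" "tree_children T w \<subseteq> U - {w}"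
proof -
  have "wf ((parent_rel T)\<inverse>)"
    using acyclic_parent_rel finite_nodes parent_rel_subset_nodes
    by (meson finite_SigmaI finite_acyclic_wf_converse finite_subset)
  then obtain w where w: "w \<in> U" "\<And>p. (w, p) \<in> parent_rel T \<Longrightarrow> p \<notin> U"
    using assms(2) by (metis converseI wfE_min')
  hence "w \<notin> tree_children T z" if "z \<in> U" for z
    using that by (auto simp: tree_children_def)
  hence "tree_children T z \<subseteq> U - {w}" if "z \<in> U" for z
    using that assms(1) by (auto simp: children_closed_def)
  thus thesis using w(1) assms(1) by (intro that) (auto simp: children_closed_def)
qed

lemma forest_sum_arcs_into:
  assumes "children_closed T U"
  shows "forest_sum (tnodes T) (link_row T X) =
    (\<Prod>z\<in>U. (X + of_nat (interior_degree T z)) ^ card (tree_children T z)) *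
    forest_sum (tnodes T) (force (arcs_into T U) (link_row T X))"
proof -
  have "finite U" using assms finite_nodes by (auto simp: children_closed_def intro: finite_subset)
  thus ?thesis using assms
  proof (induction U rule: finite_psubset_induct)
    case (psubset U)
    show ?case
    proof (cases "U = {}")
      case True
      thus ?thesis by (simp add: force_empty arcs_into_def)
    next
      case False
      then obtain w where w: "w \<in> U" "children_closed T (U - {w})" "tree_children T w \<subseteq> U - {w}"
        using children_closed_remove_top psubset.prems by blast
      have "w \<in> tnodes T" using w(1) psubset.prems by (auto simp: children_closed_def)
      hence "forest_sum (tnodes T) (force (arcs_into T (U - {w})) (link_row T X)) =
          (X + of_nat (interior_degree T w)) ^ card (tree_children T w) *
          forest_sum (tnodes T) (force (arcs_into T U) (link_row T X))"
        using forest_sum_arcs_into_insert[OF w(2) _ w(3)] w(1) by (simp add: insert_absorb)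
      thus ?thesis
        using psubset.IH[of "U - {w}"] w psubset.hyps
        by (auto simp: prod.remove[of U w] ac_simps)
    qed
  qed
qed

lemma prod_nodes_eq_prod_interior:
  "(\<Prod>z\<in>tnodes T. F z ^ card (tree_children T z)) =
    (\<Prod>z\<in>interior_nodes T. F z ^ card (tree_children T z))"
  using finite_nodes
  by (intro prod.mono_neutral_right) (auto simp: interior_nodes_def tree_leaves_def)

lemma forest_sum_link_row:
  "forest_sum (tnodes T) (link_row T X) =
    X * (\<Prod>z\<in>interior_nodes T. (X + of_nat (interior_degree T z)) ^ card (tree_children T z))"
proof -
  have "children_closed T (tnodes T)"
    using children_subset_nodes by (simp add: children_closed_def)
  moreover have "arcs_into T (tnodes T) = parent_map T"
  proof -
    have "arcs_into T (tnodes T) x = Some w \<longleftrightarrow> parent_map T x = Some w" for x w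
      using parent_rel_subset_nodes
      by (auto simp: arcs_into_eq_Some_iff parent_map_eq_Some_iff tree_children_def)
    thus ?thesis by (metis ext not_Some_eq)
  qed
  ultimately show ?thesis
    using forest_sum_arcs_into[of "tnodes T" X]
      forest_sum_force_rooted_tree[OF finite_nodes parent_map_rooted_tree, of "link_row T X"]
    by (simp add: prod_nodes_eq_prod_interior link_row_def mult.commute)
qed

lemma forest_sum_interior_sources:
  "forest_sum (tnodes T) (link_row T X) =
    (\<Prod>z\<in>interior_nodes T. X + of_nat (interior_degree T z)) *
    forest_sum (tree_leaves T) (link_row T X)"
proof -
  have "forest_sum (interior_nodes T \<union> tree_leaves T) (link_row T X) =
      (\<Prod>z\<in>interior_nodes T. sum (link_row T X z) (targets (tree_leaves T))) *
      forest_sum (tree_leaves T) (link_row T X)"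
    using finite_nodes finite_leaves
    by (intro forest_sum_sources) (auto simp: interior_nodes_def link_row_def)
  thus ?thesis by (simp add: sum_link_row finite_leaves flip: nodes_eq)
qed

end

section \<open>Spanning trees of cographs\<close>

lemma rooted_cotree_if_is_cotree_of: "is_cotree_of T V E \<Longrightarrow> rooted_cotree T"
  by (simp add: is_cotree_of_def rooted_cotree_def)

lemma forest_sum_adjacency_row_eq_link_row:
  assumes "is_cotree_of T V E"
  shows "forest_sum V (adjacency_row E X) = forest_sum V (link_row T X)"
proof -
  interpret rooted_cotree T using assms by (rule rooted_cotree_if_is_cotree_of)
  have leaves: "tree_leaves T = V"
    and adjacent: "\<And>u x. \<lbrakk>u \<in> V; x \<in> V; u \<noteq> x\<rbrakk> \<Longrightarrow> {u, x} \<in> E \<longleftrightarrow> tlabel T (lca T u x) = JoinNode"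
    using assms by (auto simp: is_cotree_of_def)
  have "finite V" using finite_leaves leaves by simp
  have "adjacency_row E X u y = link_row T X u y"
    if "u \<in> V" "y \<in> targets V" "y \<notin> targets_reaching V Map.empty u" for u y
  proof (cases y)
    case (Some x)
    hence "x \<in> V" "u \<noteq> x" using that by (auto simp: targets_def targets_reaching_def)
    thus ?thesis
      using Some that(1) adjacent[of u x] lca_leaves_eq_lca_parent[of u x] leaves
      by (simp add: adjacency_row_def link_row_def)
  qed (simp add: adjacency_row_def link_row_def)
  thus ?thesis
    using forest_sum_force_cong[of V Map.empty "adjacency_row E X" "link_row T X"] \<open>finite V\<close>
    by (simp add: force_empty)
qed

lemma forest_sum_adjacency_row:
  fixes X :: "'b::idom"
  assumes "is_cotree_of T V E"
    and nonzero: "\<And>z. z \<in> interior_nodes T \<Longrightarrow> X + of_nat (interior_degree T z) \<noteq> 0"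
  shows "forest_sum V (adjacency_row E X) = X *
    (\<Prod>z\<in>interior_nodes T. (X + of_nat (interior_degree T z)) ^ (card (tree_children T z) - 1))"
proof -
  interpret rooted_cotree T using assms(1) by (rule rooted_cotree_if_is_cotree_of)
  let ?Q = "\<lambda>z. X + of_nat (interior_degree T z)" and ?k = "\<lambda>z. card (tree_children T z)"
  have "?Q z ^ ?k z = ?Q z * ?Q z ^ (?k z - 1)" if "z \<in> interior_nodes T" for z
  proof -
    have "?k z > 0"
      using that finite_children by (auto simp: interior_nodes_def tree_leaves_def card_gt_0_iff)
    thus ?thesis by (simp add: power_eq_if)
  qed
  hence "(\<Prod>z\<in>interior_nodes T. ?Q z ^ ?k z) =
      (\<Prod>z\<in>interior_nodes T. ?Q z) * (\<Prod>z\<in>interior_nodes T. ?Q z ^ (?k z - 1))"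
    by (simp flip: prod.distrib cong: prod.cong)
  moreover have "(\<Prod>z\<in>interior_nodes T. ?Q z) * forest_sum V (adjacency_row E X) =
      X * (\<Prod>z\<in>interior_nodes T. ?Q z ^ ?k z)"
    using forest_sum_interior_sources[of X] forest_sum_link_row[of X] assms(1)
      forest_sum_adjacency_row_eq_link_row[OF assms(1), of X]
    by (simp add: is_cotree_of_def)
  moreover have "(\<Prod>z\<in>interior_nodes T. ?Q z) \<noteq> 0"
    using nonzero finite_nodes by (simp add: interior_nodes_def)
  ultimately show ?thesis by (simp add: mult.left_commute)
qed

lemma card_mult_card_spanning_trees:
  assumes "simple_graph V E" "is_cotree_of T V E"
  shows "card V * card (spanning_trees V E) =
    (\<Prod>z\<in>interior_nodes T. interior_degree T z ^ (card (tree_children T z) - 1))"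
proof -
  let ?X = "[:0, 1:] :: int poly"
  let ?P = "\<Prod>z\<in>interior_nodes T.
    (?X + of_nat (interior_degree T z)) ^ (card (tree_children T z) - 1)"
  have "coeff (?X + of_nat d) 1 = 1" for d by (simp add: of_nat_poly)
  hence "?X + of_nat d \<noteq> 0" for d by (metis coeff_0 zero_neq_one)
  hence "forest_sum V (adjacency_row E ?X) = ?X * ?P"
    using forest_sum_adjacency_row[OF assms(2), of ?X] by simp
  hence "int (card V * card (spanning_trees V E)) = poly ?P 0"
    using coeff_forest_sum_adjacency_row[OF assms(1), where 'b = int]
    by (simp add: coeff_pCons poly_0_coeff_0)
  also have "\<dots> = int (\<Prod>z\<in>interior_nodes T. interior_degree T z ^ (card (tree_children T z) - 1))"
    by (simp add: poly_prod)
  finally show ?thesis by (simp only: of_nat_eq_iff)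
qed

lemma card_spanning_trees_cotree:
  assumes "simple_graph V E" "connected_graph V E" "is_cotree_of T V E"
  shows "card (spanning_trees V E) =
    (\<Prod>z\<in>interior_nodes T - {troot T}. interior_degree T z ^ (card (tree_children T z) - 1)) *
    card V ^ (card (tree_children T (troot T)) - 2)"
    (is "_ = ?P * _")
proof -
  interpret rooted_cotree T using assms(3) by (rule rooted_cotree_if_is_cotree_of)
  have leaves: "tree_leaves T = V" using assms(3) by (simp add: is_cotree_of_def)
  note count = card_mult_card_spanning_trees[OF assms(1,3)]
  show ?thesis
  proof (cases "troot T \<in> interior_nodes T")
    case True
    let ?k = "card (tree_children T (troot T))"
    have "2 \<le> ?k" and label: "tlabel T (troot T) = JoinNode"
      using assms(2,3) True by (simp_all add: is_cotree_of_def)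
    hence "?k - 1 = Suc (?k - 2)" by simp
    moreover have "finite (interior_nodes T)" using finite_nodes by (simp add: interior_nodes_def)
    ultimately have "card V * card (spanning_trees V E) = card V * (?P * card V ^ (?k - 2))"
      using count interior_degree_root[OF True label] leaves True
      by (auto simp: prod.remove[of _ "troot T"] ac_simps)
    thus ?thesis
      using assms(2) finite_leaves leaves by (auto simp: connected_graph_def)
  next
    case False
    thus ?thesis using count root_not_interiorD leaves by simp
  qed
qed

lemma bij_betw_remove_first:
  fixes w :: "nat \<Rightarrow> 'a"
  assumes "bij_betw w {1..r} A" "1 \<le> r"
  shows "bij_betw w {2..r} (A - {w 1})"
proof -
  have "{1..r} - {1} = {2..r}" by auto
  moreover have "bij_betw w ({1..r} - {1}) (A - {w 1})"
    using assms(2) bij_betw_apply[OF assms(1)] by (intro bij_betw_DiffI[OF assms(1)]) auto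
  ultimately show ?thesis by simp
qed

theorem theorem4p1:
  fixes V :: "'a set" and E :: "'a set set" and T :: "'a cotree"
    and w :: "nat \<Rightarrow> 'a" and s t :: "nat \<Rightarrow> nat" and n r :: nat
  assumes "cograph V E" and "connected_graph V E" and "card V = n"
    and "is_cotree_of T V E"
    and "bij_betw w {1..r} (interior_nodes T)" and "w 1 = troot T"
    and "\<And>i. i \<in> {1..r} \<Longrightarrow> s i = num_interior_children T (w i)"
    and "\<And>i. i \<in> {1..r} \<Longrightarrow> t i = num_leaf_children T (w i)"
  shows "card (spanning_trees V E) =
    (\<Prod>i = 2..r. interior_degree T (w i) ^ (s i + t i - 1)) * n ^ (s 1 + t 1 - 2)"
proof -
  interpret rooted_cotree T using assms(4) by (rule rooted_cotree_if_is_cotree_of)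
  have children: "s i + t i = card (tree_children T (w i))" if "i \<in> {1..r}" for i
    using assms(7,8)[OF that] num_interior_children_plus_num_leaf_children by simp
  have "simple_graph V E" using assms(1) by (simp add: cograph_def)
  note formula = card_spanning_trees_cotree[OF this assms(2,4), unfolded assms(3)]
  show ?thesis
  proof (cases "r = 0")
    case True
    hence no_interior: "interior_nodes T = {}" using assms(5) by (simp add: bij_betw_def)
    hence "V = {troot T}"
      using root_not_interiorD(2) assms(4) by (simp add: is_cotree_of_def)
    hence "n = 1" using assms(3) by simp
    thus ?thesis using True no_interior formula by simp
  next
    case False
    hence "bij_betw w {2..r} (interior_nodes T - {troot T})"
      using bij_betw_remove_first[OF assms(5)] assms(6) by simp
    thus ?thesis
      unfolding formula using False children children[of 1] assms(6)
      by (simp flip: prod.reindex_bij_betw)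
  qed
qed

end
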